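(* Let $(q,p,Q,P)$, $q,p,Q,P\in\mathbb{R}^n$, be symplectic coordinates on the product manifold $\tilde M=M_1\times M_2$ with $\omega_\ominus=\sum_i(dp_i\wedge dq_i-dP_i\wedge dQ_i)$, and let $(x,X,y,Y)$ be coordinates on $T^*(\mathcal{Q}_1\times\mathcal{Q}_2)$ with Liouville form $\theta_{\mathcal{Q}_1\times\mathcal{Q}_2}=\sum_i(y_i\,dx_i+Y_i\,dX_i)$. Consider the symplectomorphisms $\tilde M\to T^*(\mathcal{Q}_1\times\mathcal{Q}_2)$ given by $$E_1(q,p,Q,P)=(q,-Q,p,P),\qquad \Psi_{ii}(q,p,Q,P)=(q,P,p,Q),$$ $$\Psi_{iii}(q,p,Q,P)=(Q,p,-P,-q),\qquad \Psi_{iv}(q,p,Q,P)=(-p,P,q,Q).$$ Then the Liouvillian forms $E_1^*\theta_{\mathcal{Q}_1\times\mathcal{Q}_2}$, $\Psi_{ii}^*\theta_{\mathcal{Q}_1\times\mathcal{Q}_2}$, $\Psi_{iii}^*\theta_{\mathcal{Q}_1\times\mathcal{Q}_2}$, $\Psi_{iv}^*\theta_{\mathcal{Q}_1\times\mathcal{Q}_2}$ on $\tilde M$ are associated to the generating functions of type I, II, III and IV, respectively.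
   Context: $M_1,M_2$ are two copies of a symplectic manifold with Darboux coordinates $(q,p)$ and $(Q,P)$ respectively, and $\omega_\ominus=\pi_1^*\omega_1-\pi_2^*\omega_2$. A Liouvillian form on $\tilde M$ is a 1-form $\theta$ with $d\theta=\omega_\ominus$. Generating functions are smooth functions $S$ of the following variables, defining Lagrangian submanifolds of $\tilde M$ by the following equations (for all $i$): type I: $S=S(q,Q)$, $p_i=\partial S/\partial q_i$, $P_i=-\partial S/\partial Q_i$; type II: $S=S(q,P)$, $p_i=\partial S/\partial q_i$, $Q_i=\partial S/\partial P_i$; type III: $S=S(Q,p)$, $q_i=-\partial S/\partial p_i$, $P_i=-\partial S/\partial Q_i$; type IV: $S=S(p,P)$, $q_i=-\partial S/\partial p_i$, $Q_i=\partial S/\partial P_i$. A Liouvillian form $\theta$ on $\tilde M$ is said to be associated to generating functions of a given type if, for every function $S$ of the corresponding variables (regarded as a function on $\tilde M$), the set of points of $\tilde M$ at which the covectors $\theta$ and $dS$ coincide is exactly the Lagrangian submanifold defined by the equations of that type. *)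

theory Defs
  imports "HOL-Analysis.Analysis"
begin

text \<open>
  Everything is expressed in coordinates. Points of the product manifold are written
  (q, p, Q, P) and points of the cotangent bundle of the product of the two
  configuration spaces (x, X, y, Y), with base point (x, X) and fibre coordinates (y, Y).
\<close>

type_synonym 'n coords = "(real ^ 'n) \<times> (real ^ 'n) \<times> (real ^ 'n) \<times> (real ^ 'n)"

text \<open>The coordinate domain of a product, given those of the factors in the coordinates
  (q, p) and (Q, P).\<close>

definition product_domain ::
    "((real ^ 'n) \<times> (real ^ 'n)) set \<Rightarrow> ((real ^ 'n) \<times> (real ^ 'n)) set \<Rightarrow> 'n::finite coords set" where
  "product_domain M1 M2 = {(q, p, Q, P). (q, p) \<in> M1 \<and> (Q, P) \<in> M2}"

text \<open>Only used on open sets, where the derivative depends on nothing outside the set.\<close>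

primrec C_k_on :: "nat \<Rightarrow> 'a::euclidean_space set \<Rightarrow> ('a \<Rightarrow> 'b::euclidean_space) \<Rightarrow> bool" where
  "C_k_on 0 A f \<longleftrightarrow> continuous_on A f"
| "C_k_on (Suc k) A f \<longleftrightarrow>
     (\<forall>x\<in>A. f differentiable (at x)) \<and> (\<forall>v. C_k_on k A (\<lambda>x. frechet_derivative f (at x) v))"

definition smooth_on :: "'a::euclidean_space set \<Rightarrow> ('a \<Rightarrow> 'b::euclidean_space) \<Rightarrow> bool" where
  "smooth_on A f \<longleftrightarrow> (\<forall>k. C_k_on k A f)"

type_synonym 'a one_form = "'a \<Rightarrow> 'a \<Rightarrow> real"
type_synonym 'a two_form = "'a \<Rightarrow> 'a \<Rightarrow> 'a \<Rightarrow> real"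

definition smooth_one_form_on :: "'a::euclidean_space set \<Rightarrow> 'a one_form \<Rightarrow> bool" where
  "smooth_one_form_on A \<theta> \<longleftrightarrow> (\<forall>z\<in>A. linear (\<theta> z)) \<and> (\<forall>v. smooth_on A (\<lambda>z. \<theta> z v))"

definition differential :: "('a::euclidean_space \<Rightarrow> real) \<Rightarrow> 'a one_form" where
  "differential f z = frechet_derivative f (at z)"

definition wedge :: "'a one_form \<Rightarrow> 'a one_form \<Rightarrow> 'a two_form" where
  "wedge \<alpha> \<beta> z u v = \<alpha> z u * \<beta> z v - \<alpha> z v * \<beta> z u"

text \<open>The usual formula for the exterior derivative of a 1-form, evaluated on constant
  vector fields u and v (whose bracket vanishes).\<close>

definition ext_derivative :: "'a::euclidean_space one_form \<Rightarrow> 'a two_form" where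
  "ext_derivative \<theta> z u v =
     frechet_derivative (\<lambda>w. \<theta> w v) (at z) u - frechet_derivative (\<lambda>w. \<theta> w u) (at z) v"

definition pullback1 ::
    "('a::euclidean_space \<Rightarrow> 'b::euclidean_space) \<Rightarrow> 'b one_form \<Rightarrow> 'a one_form" where
  "pullback1 f \<theta> z v = \<theta> (f z) (frechet_derivative f (at z) v)"

definition pullback2 ::
    "('a::euclidean_space \<Rightarrow> 'b::euclidean_space) \<Rightarrow> 'b two_form \<Rightarrow> 'a two_form" where
  "pullback2 f \<omega> z u v = \<omega> (f z) (frechet_derivative f (at z) u) (frechet_derivative f (at z) v)"

definition omega_ominus :: "'n::finite coords two_form" where
  "omega_ominus z u v =
     (\<Sum>i\<in>UNIV. wedge (differential (\<lambda>(q, p, Q, P). p $ i)) (differential (\<lambda>(q, p, Q, P). q $ i)) z u v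
             - wedge (differential (\<lambda>(q, p, Q, P). P $ i)) (differential (\<lambda>(q, p, Q, P). Q $ i)) z u v)"

definition liouville_form :: "'n::finite coords one_form" where
  "liouville_form = (\<lambda>(x, X, y, Y) v.
     \<Sum>i\<in>UNIV. y $ i * differential (\<lambda>(x, X, y, Y). x $ i) (x, X, y, Y) v
            + Y $ i * differential (\<lambda>(x, X, y, Y). X $ i) (x, X, y, Y) v)"

definition symplectomorphism ::
    "'a::euclidean_space set \<Rightarrow> 'a two_form \<Rightarrow> 'b::euclidean_space set \<Rightarrow> 'b two_form \<Rightarrow> ('a \<Rightarrow> 'b) \<Rightarrow> bool" where
  "symplectomorphism A \<omega> B \<omega>' f \<longleftrightarrow>
     open A \<and> open B \<and> smooth_on A f \<and>
     (\<exists>g. homeomorphism A B f g \<and> smooth_on B g) \<and>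
     (\<forall>z\<in>A. pullback2 f \<omega>' z = \<omega> z)"

definition liouvillian_form :: "'n::finite coords set \<Rightarrow> 'n coords one_form \<Rightarrow> bool" where
  "liouvillian_form M \<theta> \<longleftrightarrow>
     smooth_one_form_on M \<theta> \<and> (\<forall>z\<in>M. ext_derivative \<theta> z = omega_ominus z)"

text \<open>Near each of its points, L is the image of a smooth embedding of an open subset
  of a space of half the dimension, pulling the symplectic form back to zero.
  The empty set counts as a Lagrangian submanifold.\<close>

definition lagrangian_submanifold :: "'n::finite coords set \<Rightarrow> bool" where
  "lagrangian_submanifold L \<longleftrightarrow>
     (\<forall>z\<in>L. \<exists>U V. \<exists>\<phi> :: (real ^ 'n) \<times> (real ^ 'n) \<Rightarrow> 'n coords. \<exists>\<psi>.
        open U \<and> z \<in> U \<and> open V \<and> smooth_on V \<phi> \<and> homeomorphism V (L \<inter> U) \<phi> \<psi> \<and>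
        (\<forall>w\<in>V. inj (frechet_derivative \<phi> (at w)) \<and>
                (\<forall>u v. pullback2 \<phi> omega_ominus w u v = 0)))"

definition partial1 ::
    "((real ^ 'n) \<times> (real ^ 'n) \<Rightarrow> real) \<Rightarrow> 'n::finite \<Rightarrow> (real ^ 'n) \<times> (real ^ 'n) \<Rightarrow> real" where
  "partial1 S i = (\<lambda>(a, b). deriv (\<lambda>t. S (a + t *\<^sub>R axis i 1, b)) 0)"

definition partial2 ::
    "((real ^ 'n) \<times> (real ^ 'n) \<Rightarrow> real) \<Rightarrow> 'n::finite \<Rightarrow> (real ^ 'n) \<times> (real ^ 'n) \<Rightarrow> real" where
  "partial2 S i = (\<lambda>(a, b). deriv (\<lambda>t. S (a, b + t *\<^sub>R axis i 1)) 0)"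

datatype gen_type = Type_I | Type_II | Type_III | Type_IV

text \<open>The variables of a generating function, in the order (q, Q), (q, P), (Q, p), (p, P).\<close>

fun gen_vars :: "gen_type \<Rightarrow> 'n::finite coords \<Rightarrow> (real ^ 'n) \<times> (real ^ 'n)" where
  "gen_vars Type_I (q, p, Q, P) = (q, Q)"
| "gen_vars Type_II (q, p, Q, P) = (q, P)"
| "gen_vars Type_III (q, p, Q, P) = (Q, p)"
| "gen_vars Type_IV (q, p, Q, P) = (p, P)"

fun gen_equations ::
    "gen_type \<Rightarrow> ((real ^ 'n) \<times> (real ^ 'n) \<Rightarrow> real) \<Rightarrow> 'n::finite coords \<Rightarrow> bool" where
  "gen_equations Type_I S (q, p, Q, P) \<longleftrightarrow>
     (\<forall>i. p $ i = partial1 S i (q, Q) \<and> P $ i = - partial2 S i (q, Q))"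
| "gen_equations Type_II S (q, p, Q, P) \<longleftrightarrow>
     (\<forall>i. p $ i = partial1 S i (q, P) \<and> Q $ i = partial2 S i (q, P))"
| "gen_equations Type_III S (q, p, Q, P) \<longleftrightarrow>
     (\<forall>i. q $ i = - partial2 S i (Q, p) \<and> P $ i = - partial1 S i (Q, p))"
| "gen_equations Type_IV S (q, p, Q, P) \<longleftrightarrow>
     (\<forall>i. q $ i = - partial1 S i (p, P) \<and> Q $ i = partial2 S i (p, P))"

text \<open>A generating function on M is a smooth function on the range of the variables of
  its type; composing it with \<^term>\<open>gen_vars t\<close> regards it as a function on M.
  Both sides of the last equation of covectors are functionals on the whole tangent space.\<close>

definition associated_to :: "'n::finite coords set \<Rightarrow> 'n coords one_form \<Rightarrow> gen_type \<Rightarrow> bool" where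
  "associated_to M \<theta> t \<longleftrightarrow>
     (\<forall>S. smooth_on (gen_vars t ` M) S \<longrightarrow>
        lagrangian_submanifold {z \<in> M. gen_equations t S z} \<and>
        {z \<in> M. \<theta> z = differential (S \<circ> gen_vars t) z} = {z \<in> M. gen_equations t S z})"

definition E_1 :: "'n::finite coords \<Rightarrow> 'n coords" where
  "E_1 = (\<lambda>(q, p, Q, P). (q, - Q, p, P))"

definition Psi_ii :: "'n::finite coords \<Rightarrow> 'n coords" where
  "Psi_ii = (\<lambda>(q, p, Q, P). (q, P, p, Q))"

definition Psi_iii :: "'n::finite coords \<Rightarrow> 'n coords" where
  "Psi_iii = (\<lambda>(q, p, Q, P). (Q, p, - P, - q))"

definition Psi_iv :: "'n::finite coords \<Rightarrow> 'n coords" where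
  "Psi_iv = (\<lambda>(q, p, Q, P). (- p, P, q, Q))"

end

theory Submission
  imports Defs
begin

text \<open>
  Each of the four forms is \<open>\<theta> z v = \<eta> z \<bullet> \<pi> v\<close>, where \<open>\<pi>\<close> selects the variables
  of the generating function and \<open>\<eta>\<close> the conjugate variables, up to sign. As \<open>\<pi>\<close> is
  surjective, \<open>\<theta> = d(S \<circ> \<pi>)\<close> at \<open>z\<close> amounts to \<open>\<eta> z = \<nabla>S (\<pi> z)\<close>, which is the system
  of equations of the given type. Its solution set is the graph of \<open>\<nabla>S\<close> in the linear
  coordinates \<open>(\<pi>, \<eta>)\<close>, and it is Lagrangian because the Hessian of \<open>S\<close> is symmetric.
\<close>

section \<open>Smooth functions\<close>

text \<open>On an open set, agreement on \<open>A\<close> is agreement near each point of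
  \<open>A\<close>, so the derivatives agree too and the induction can pass to them. This lets the
  later inductions replace the derivative of a compound expression by a formula that holds only on
  \<open>A\<close>.\<close>

lemma C_k_on_cong:
  assumes "open A" "\<And>x. x \<in> A \<Longrightarrow> f x = g x" "C_k_on k A f"
  shows "C_k_on k A g"
  using assms(2,3)
proof (induction k arbitrary: f g)
  case 0
  then show ?case by (simp cong: continuous_on_cong)
next
  case (Suc k)
  have "g differentiable (at x)" if "x \<in> A" for x
    using Suc.prems that has_derivative_transform_within_open[OF _ assms(1) that, of f _ UNIV g]
    unfolding differentiable_def C_k_on.simps by metis
  moreover have "C_k_on k A (\<lambda>x. frechet_derivative g (at x) v)" for v
  proof (rule Suc.IH)
    show "C_k_on k A (\<lambda>x. frechet_derivative f (at x) v)"
      using Suc.prems by simp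
    show "frechet_derivative f (at x) v = frechet_derivative g (at x) v" if "x \<in> A" for x
      using frechet_derivative_transform_within_open[of f x A g] Suc.prems that assms(1) by simp
  qed
  ultimately show ?case by simp
qed

lemma C_k_on_subset: "C_k_on k A f \<Longrightarrow> B \<subseteq> A \<Longrightarrow> C_k_on k B f"
  by (induction k arbitrary: f) (auto intro: continuous_on_subset)

lemma C_k_on_const: "C_k_on k A (\<lambda>_. c)"
  by (induction k arbitrary: c) auto

lemma frechet_derivative_linear:
  fixes f :: "'a::euclidean_space \<Rightarrow> 'b::real_normed_vector"
  shows "linear f \<Longrightarrow> frechet_derivative f (at x) = f"
  by (rule frechet_derivative_at[OF linear_imp_has_derivative, symmetric])

text \<open>The derivative of \<open>f\<close> in a fixed direction \<open>v\<close> is the constant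
  \<open>f v\<close>, so a case distinction on \<open>k\<close> replaces an induction.\<close>

lemma C_k_on_linear: "linear f \<Longrightarrow> C_k_on k A f"
  by (cases k) (simp_all add: frechet_derivative_linear C_k_on_const linear_imp_differentiable
      linear_continuous_on linear_conv_bounded_linear[THEN iffD1])

text \<open>Differentiating \<open>L\<close> after \<open>f\<close> in direction \<open>v\<close>
  gives \<open>L\<close> after the directional derivative of \<open>f\<close>, an expression of the
  same shape, so the induction closes. Linear images and sums are the operations from which
  gradients and graph parametrizations are assembled below.\<close>

lemma C_k_on_linear_compose:
  assumes "open A" "linear L" "C_k_on k A f"
  shows "C_k_on k A (\<lambda>x. L (f x))"
  using assms(3)
proof (induction k arbitrary: f)
  case 0
  then show ?case
    using linear_continuous_on_compose[OF _ assms(2)] by simp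
next
  case (Suc k)
  have D: "((\<lambda>x. L (f x)) has_derivative (\<lambda>v. L (frechet_derivative f (at x) v))) (at x)"
    if "x \<in> A" for x
    using Suc.prems that assms(2)
    by (auto simp: frechet_derivative_works linear_conv_bounded_linear
        intro: bounded_linear.has_derivative)
  have "C_k_on k A (\<lambda>x. frechet_derivative (\<lambda>x. L (f x)) (at x) v)" for v
  proof (rule C_k_on_cong[OF assms(1)])
    show "C_k_on k A (\<lambda>x. L (frechet_derivative f (at x) v))"
      using Suc by simp
  qed (simp add: frechet_derivative_at[OF D, symmetric])
  with D show ?case by (auto simp: differentiable_def)
qed

lemma C_k_on_add:
  assumes "open A" "C_k_on k A f" "C_k_on k A g"
  shows "C_k_on k A (\<lambda>x. f x + g x)"
  using assms(2,3)
proof (induction k arbitrary: f g)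
  case 0
  then show ?case by (simp add: continuous_on_add)
next
  case (Suc k)
  have D: "((\<lambda>x. f x + g x) has_derivative
      (\<lambda>v. frechet_derivative f (at x) v + frechet_derivative g (at x) v)) (at x)"
    if "x \<in> A" for x
    using Suc.prems that by (intro has_derivative_add) (auto simp: frechet_derivative_works)
  have "C_k_on k A (\<lambda>x. frechet_derivative (\<lambda>x. f x + g x) (at x) v)" for v
  proof (rule C_k_on_cong[OF assms(1)])
    show "C_k_on k A (\<lambda>x. frechet_derivative f (at x) v + frechet_derivative g (at x) v)"
      using Suc by simp
  qed (simp add: frechet_derivative_at[OF D, symmetric])
  with D show ?case by (auto simp: differentiable_def)
qed

lemma smooth_on_linear: "linear f \<Longrightarrow> smooth_on A f"
  by (simp add: smooth_on_def C_k_on_linear)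

lemma smooth_on_linear_compose:
  "open A \<Longrightarrow> linear L \<Longrightarrow> smooth_on A f \<Longrightarrow> smooth_on A (\<lambda>x. L (f x))"
  by (simp add: smooth_on_def C_k_on_linear_compose)

lemma smooth_on_sum:
  assumes "open A" "\<And>i. i \<in> I \<Longrightarrow> smooth_on A (f i)"
  shows "smooth_on A (\<lambda>x. \<Sum>i\<in>I. f i x)"
  using assms(2)
  by (induction I rule: infinite_finite_induct)
     (simp_all add: smooth_on_def C_k_on_const C_k_on_add[OF assms(1)])

lemma smooth_on_Pair:
  fixes f :: "'a::euclidean_space \<Rightarrow> 'b::euclidean_space" and g :: "'a \<Rightarrow> 'c::euclidean_space"
  assumes "open A" "smooth_on A f" "smooth_on A g"
  shows "smooth_on A (\<lambda>x. (f x, g x))"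
proof -
  \<comment> \<open>A pair is the sum of the images of its components under the two linear
    inclusions of the factors.\<close>
  have "linear (\<lambda>a::'b. (a, 0::'c))" "linear (\<lambda>b::'c. (0::'b, b))"
    by (auto intro!: linearI)
  from this[THEN smooth_on_linear_compose[OF assms(1)]]
  have "smooth_on A (\<lambda>x. (f x, 0::'c))" "smooth_on A (\<lambda>x. (0::'b, g x))"
    using assms(2,3) by simp_all
  then have "smooth_on A (\<lambda>x. (f x, 0) + (0, g x))"
    using C_k_on_add[OF assms(1)] unfolding smooth_on_def by blast
  then show ?thesis by simp
qed

lemma smooth_on_subset: "smooth_on A f \<Longrightarrow> B \<subseteq> A \<Longrightarrow> smooth_on B f"
  unfolding smooth_on_def by (blast intro: C_k_on_subset)

lemma smooth_on_imp_continuous_on: "smooth_on A f \<Longrightarrow> continuous_on A f"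
  unfolding smooth_on_def by (drule spec[of _ 0]) simp

lemma smooth_on_imp_differentiable: "smooth_on A f \<Longrightarrow> x \<in> A \<Longrightarrow> f differentiable (at x)"
  unfolding smooth_on_def by (drule spec[of _ 1]) simp

lemma smooth_on_frechet_derivative:
  "smooth_on A f \<Longrightarrow> smooth_on A (\<lambda>x. frechet_derivative f (at x) v)"
  unfolding smooth_on_def
proof
  fix k
  assume "\<forall>k. C_k_on k A f"
  then have "C_k_on (Suc k) A f" ..
  then show "C_k_on k A (\<lambda>x. frechet_derivative f (at x) v)" by simp
qed

section \<open>Symmetry of second derivatives\<close>

text \<open>This is the one-variable mean value theorem for the restriction of \<open>f\<close> to
  the segment from \<open>x\<close> to \<open>x + h *\<^sub>R v\<close>; the chain rule identifies
  the derivative of the restriction.\<close>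

lemma mean_value_along_line:
  fixes f :: "'a::real_normed_vector \<Rightarrow> real"
  assumes "0 < h" "\<And>s. 0 \<le> s \<Longrightarrow> s \<le> h \<Longrightarrow> f differentiable (at (x + s *\<^sub>R v))"
  obtains s where "0 < s" "s < h"
    "f (x + h *\<^sub>R v) - f x = h * frechet_derivative f (at (x + s *\<^sub>R v)) v"
proof -
  have D: "((\<lambda>s. f (x + s *\<^sub>R v)) has_derivative
      (\<lambda>d. d * frechet_derivative f (at (x + s *\<^sub>R v)) v)) (at s)"
    if "0 \<le> s" "s \<le> h" for s
  proof -
    have f: "(f has_derivative frechet_derivative f (at (x + s *\<^sub>R v))) (at (x + s *\<^sub>R v))"
      using assms(2)[OF that] by (simp add: frechet_derivative_works)
    have "((\<lambda>s. x + s *\<^sub>R v) has_derivative (\<lambda>d. d *\<^sub>R v)) (at s)"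
      by (auto intro!: derivative_eq_intros)
    from has_derivative_compose[OF this f] show ?thesis
      using linear_frechet_derivative[OF assms(2)[OF that]] by (simp add: linear_cmul)
  qed
  have "\<exists>s\<in>{0<..<h}. f (x + h *\<^sub>R v) - f (x + 0 *\<^sub>R v) =
      (\<lambda>d. d * frechet_derivative f (at (x + s *\<^sub>R v)) v) (h - 0)"
    using D by (intro mvt_simple assms(1)) (auto intro: has_derivative_at_withinI)
  then show ?thesis by (auto intro: that)
qed

text \<open>Two applications of the mean value theorem, first along \<open>u\<close> and then along
  \<open>v\<close>, each contribute a factor \<open>h\<close>. The bound on \<open>h\<close> keeps
  the parallelogram spanned by \<open>h *\<^sub>R u\<close> and \<open>h *\<^sub>R v\<close> at
  \<open>w\<close> inside the ball.\<close>

lemma second_difference_eq: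
  fixes S :: "'a::euclidean_space \<Rightarrow> real"
  assumes "smooth_on V S" "ball w r \<subseteq> V" "0 < h" "h * (norm u + norm v) < r"
  obtains p where "p \<in> ball w r"
    "S (w + h *\<^sub>R u + h *\<^sub>R v) - S (w + h *\<^sub>R u) - S (w + h *\<^sub>R v) + S w =
      h * (h * frechet_derivative (\<lambda>x. frechet_derivative S (at x) u) (at p) v)"
proof -
  have in_ball: "w + s *\<^sub>R u + t *\<^sub>R v \<in> ball w r"
    if "0 \<le> s" "s \<le> h" "0 \<le> t" "t \<le> h" for s t
  proof -
    have "norm (s *\<^sub>R u + t *\<^sub>R v) \<le> s * norm u + t * norm v"
      using norm_triangle_ineq[of "s *\<^sub>R u" "t *\<^sub>R v"] that by simp
    also have "\<dots> \<le> h * (norm u + norm v)"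
      using that by (simp add: distrib_left add_mono mult_right_mono)
    finally show ?thesis
      using assms(4) norm_minus_commute[of w "w + s *\<^sub>R u + t *\<^sub>R v"]
      by (simp add: dist_norm add.assoc)
  qed
  have dS: "S differentiable (at (w + s *\<^sub>R u + t *\<^sub>R v))"
    and dD: "(\<lambda>x. frechet_derivative S (at x) u) differentiable (at (w + s *\<^sub>R u + t *\<^sub>R v))"
    if "0 \<le> s" "s \<le> h" "0 \<le> t" "t \<le> h" for s t
    using in_ball[OF that] assms(1,2) smooth_on_imp_differentiable smooth_on_frechet_derivative
    by blast+
  \<comment> \<open>The mixed second difference is the increment of \<open>F\<close> along
    \<open>h *\<^sub>R u\<close>.\<close>
  define F where "F x = S (x + h *\<^sub>R v) - S x" for x
  have DF: "(F has_derivative (\<lambda>d. frechet_derivative S (at (w + s *\<^sub>R u + h *\<^sub>R v)) d -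
      frechet_derivative S (at (w + s *\<^sub>R u)) d)) (at (w + s *\<^sub>R u))"
    if "0 \<le> s" "s \<le> h" for s
  proof -
    have "(S has_derivative frechet_derivative S (at (w + s *\<^sub>R u + h *\<^sub>R v)))
        (at (w + s *\<^sub>R u + h *\<^sub>R v))"
      "(S has_derivative frechet_derivative S (at (w + s *\<^sub>R u))) (at (w + s *\<^sub>R u))"
      using dS[OF that, of h] dS[OF that, of 0] assms(3) by (simp_all add: frechet_derivative_works)
    moreover have "((\<lambda>x. x + h *\<^sub>R v) has_derivative (\<lambda>d. d)) (at (w + s *\<^sub>R u))"
      by (auto intro!: derivative_eq_intros)
    ultimately show ?thesis
      unfolding F_def by (intro has_derivative_diff) (auto dest: has_derivative_compose)
  qed
  obtain s where s: "0 < s" "s < h"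
    "F (w + h *\<^sub>R u) - F w = h * frechet_derivative F (at (w + s *\<^sub>R u)) u"
    by (rule mean_value_along_line[of h F w u])
       (use DF assms(3) in \<open>auto simp: differentiable_def\<close>)
  \<comment> \<open>The derivative of \<open>F\<close> in direction \<open>u\<close> is itself an
    increment along \<open>h *\<^sub>R v\<close>, now of the directional derivative of
    \<open>S\<close>, with \<open>s\<close> held fixed.\<close>
  obtain t where t: "0 < t" "t < h"
    "frechet_derivative S (at (w + s *\<^sub>R u + h *\<^sub>R v)) u -
      frechet_derivative S (at (w + s *\<^sub>R u)) u =
     h * frechet_derivative (\<lambda>x. frechet_derivative S (at x) u)
       (at (w + s *\<^sub>R u + t *\<^sub>R v)) v"
    by (rule mean_value_along_line[of h "\<lambda>x. frechet_derivative S (at x) u" "w + s *\<^sub>R u" v])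
       (use dD s assms(3) in auto)
  show ?thesis
  proof (rule that)
    show "w + s *\<^sub>R u + t *\<^sub>R v \<in> ball w r"
      using in_ball s t by simp
    have "frechet_derivative F (at (w + s *\<^sub>R u)) u =
        frechet_derivative S (at (w + s *\<^sub>R u + h *\<^sub>R v)) u -
        frechet_derivative S (at (w + s *\<^sub>R u)) u"
      using fun_cong[OF frechet_derivative_at[OF DF[of s]], of u] s by simp
    then show "S (w + h *\<^sub>R u + h *\<^sub>R v) - S (w + h *\<^sub>R u) - S (w + h *\<^sub>R v) + S w =
      h * (h * frechet_derivative (\<lambda>x. frechet_derivative S (at x) u)
        (at (w + s *\<^sub>R u + t *\<^sub>R v)) v)"
      using s(3) t(3) by (simp add: F_def)
  qed
qed

text \<open>The mixed second difference is symmetric in \<open>u\<close> and \<open>v\<close>, so it is \<open>h\<^sup>2\<close> times either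
  mixed derivative, at points that tend to \<open>w\<close> with \<open>h\<close>.\<close>

lemma second_derivative_symmetric:
  fixes S :: "'a::euclidean_space \<Rightarrow> real"
  assumes "open V" "smooth_on V S" "w \<in> V"
  shows "frechet_derivative (\<lambda>x. frechet_derivative S (at x) u) (at w) v =
         frechet_derivative (\<lambda>x. frechet_derivative S (at x) v) (at w) u"
proof (rule ccontr)
  define A where "A = (\<lambda>p. frechet_derivative (\<lambda>x. frechet_derivative S (at x) u) (at p) v)"
  define B where "B = (\<lambda>p. frechet_derivative (\<lambda>x. frechet_derivative S (at x) v) (at p) u)"
  assume "\<not> ?thesis"
  then have neq: "A w - B w \<noteq> 0" by (simp add: A_def B_def)
  have "continuous_on V A" "continuous_on V B"
    unfolding A_def B_def
    using assms(2) by (simp_all add: smooth_on_imp_continuous_on smooth_on_frechet_derivative)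
  then have "isCont A w" "isCont B w"
    using assms(1,3) by (simp_all add: continuous_on_eq_continuous_at)
  \<comment> \<open>Half the gap is the right tolerance: the evaluation points \<open>p\<close> and
    \<open>p'\<close> may differ, but a common value \<open>A p = B p'\<close> lying within half the
    gap of both \<open>A w\<close> and \<open>B w\<close> violates the triangle inequality.\<close>
  have "0 < \<bar>A w - B w\<bar> / 2" using neq by simp
  with \<open>isCont A w\<close> \<open>isCont B w\<close> obtain d1 d2 where d: "0 < d1" "0 < d2"
    "\<And>p. dist p w < d1 \<Longrightarrow> dist (A p) (A w) < \<bar>A w - B w\<bar> / 2"
    "\<And>p. dist p w < d2 \<Longrightarrow> dist (B p) (B w) < \<bar>A w - B w\<bar> / 2"
    unfolding continuous_at_eps_delta by blast
  obtain d3 where d3: "0 < d3" "ball w d3 \<subseteq> V"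
    using assms(1,3) open_contains_ball by blast
  define r where "r = min d1 (min d2 d3)"
  have r: "0 < r" "ball w r \<subseteq> V" using d d3 by (auto simp: r_def)
  \<comment> \<open>The summand 1 keeps the denominator positive even for \<open>u = v = 0\<close>
    and makes the bound on \<open>h * (norm u + norm v)\<close> strict.\<close>
  define h where "h = r / (norm u + norm v + 1)"
  have pos: "0 < norm u + norm v + 1" by (simp add: add_nonneg_pos)
  then have h: "0 < h" using r by (simp add: h_def)
  have "h * (norm u + norm v) < h * (norm u + norm v + 1)" using h by simp
  also have "\<dots> = r" using pos by (simp add: h_def)
  finally have small: "h * (norm u + norm v) < r" "h * (norm v + norm u) < r"
    by (simp_all add: add.commute)
  obtain p where p: "p \<in> ball w r"
    "S (w + h *\<^sub>R u + h *\<^sub>R v) - S (w + h *\<^sub>R u) - S (w + h *\<^sub>R v) + S w = h * (h * A p)"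
    unfolding A_def by (rule second_difference_eq[OF assms(2) r(2) h small(1)])
  obtain p' where p': "p' \<in> ball w r"
    "S (w + h *\<^sub>R v + h *\<^sub>R u) - S (w + h *\<^sub>R v) - S (w + h *\<^sub>R u) + S w = h * (h * B p')"
    unfolding B_def by (rule second_difference_eq[OF assms(2) r(2) h small(2)])
  have swap: "w + h *\<^sub>R v + h *\<^sub>R u = w + h *\<^sub>R u + h *\<^sub>R v" by (simp add: algebra_simps)
  then have "h * (h * A p) = h * (h * B p')" using p(2) p'(2)[unfolded swap] by linarith
  then have "A p = B p'" using h by simp
  moreover have "dist (A p) (A w) < \<bar>A w - B w\<bar> / 2" "dist (B p') (B w) < \<bar>A w - B w\<bar> / 2"
    using p(1) p'(1) d(3)[of p] d(4)[of p'] by (simp_all add: r_def dist_commute)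
  ultimately show False
    using dist_triangle_half_r[of "A p" "A w" "\<bar>A w - B w\<bar>" "B w"] by (simp add: dist_real_def)
qed

section \<open>Gradients\<close>

text \<open>The vector that represents the derivative through the inner product. It turns equations
  between covectors into equations between vectors, and as a sum over the basis it inherits
  smoothness from the directional derivatives.\<close>

definition gradient :: "('a::euclidean_space \<Rightarrow> real) \<Rightarrow> 'a \<Rightarrow> 'a" where
  "gradient S w = (\<Sum>e\<in>Basis. frechet_derivative S (at w) e *\<^sub>R e)"

lemma gradient_inner:
  assumes "S differentiable (at w)"
  shows "gradient S w \<bullet> v = frechet_derivative S (at w) v"
proof -
  have "linear (frechet_derivative S (at w))"
    using assms by (rule linear_frechet_derivative)
  then have "frechet_derivative S (at w) (\<Sum>e\<in>Basis. (v \<bullet> e) *\<^sub>R e) =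
      (\<Sum>e\<in>Basis. (v \<bullet> e) * frechet_derivative S (at w) e)"
    by (simp add: linear_sum linear_cmul)
  then show ?thesis
    unfolding euclidean_representation
    by (simp add: gradient_def inner_sum_left inner_commute[of v] mult.commute)
qed

lemma smooth_on_gradient:
  assumes "open A" "smooth_on A S"
  shows "smooth_on A (gradient S)"
proof -
  have "linear (\<lambda>r. r *\<^sub>R e)" for e :: 'a
    by (rule linear_scale_left)
  then show ?thesis
    unfolding gradient_def[abs_def]
    by (intro smooth_on_sum assms smooth_on_linear_compose[OF assms(1), where L = "\<lambda>r. r *\<^sub>R _"]
        smooth_on_frechet_derivative)
qed

lemma deriv_along_line:
  fixes S :: "'a::real_normed_vector \<Rightarrow> real"
  assumes "S differentiable (at w)"
  shows "deriv (\<lambda>t. S (w + t *\<^sub>R v)) 0 = frechet_derivative S (at w) v"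
proof (rule DERIV_imp_deriv)
  \<comment> \<open>The base point is written as the value of the line at parameter 0, the form that
    the chain rule expects.\<close>
  have "(S has_derivative frechet_derivative S (at w)) (at (w + 0 *\<^sub>R v))"
    using assms by (simp add: frechet_derivative_works)
  moreover have "((\<lambda>t. w + t *\<^sub>R v) has_derivative (\<lambda>d. d *\<^sub>R v)) (at 0)"
    by (auto intro!: derivative_eq_intros)
  ultimately have "((\<lambda>t. S (w + t *\<^sub>R v)) has_derivative
      (\<lambda>d. frechet_derivative S (at w) (d *\<^sub>R v))) (at 0)"
    by (rule has_derivative_compose[rotated])
  then show "DERIV (\<lambda>t. S (w + t *\<^sub>R v)) 0 :> frechet_derivative S (at w) v"
    using linear_frechet_derivative[OF assms]
    by (simp add: has_field_derivative_def linear_cmul mult_commute_abs)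
qed

lemma partial1_eq_gradient:
  assumes "S differentiable (at w)"
  shows "partial1 S i w = fst (gradient S w) $ i"
proof -
  have "partial1 S i w = deriv (\<lambda>t. S (w + t *\<^sub>R (axis i 1, 0))) 0"
    by (cases w) (simp add: partial1_def)
  also have "\<dots> = gradient S w \<bullet> (axis i 1, 0)"
    by (simp only: deriv_along_line[OF assms] gradient_inner[OF assms])
  finally show ?thesis by (cases "gradient S w") (simp add: inner_axis)
qed

lemma partial2_eq_gradient:
  assumes "S differentiable (at w)"
  shows "partial2 S i w = snd (gradient S w) $ i"
proof -
  have "partial2 S i w = deriv (\<lambda>t. S (w + t *\<^sub>R (0, axis i 1))) 0"
    by (cases w) (simp add: partial2_def)
  also have "\<dots> = gradient S w \<bullet> (0, axis i 1)"
    by (simp only: deriv_along_line[OF assms] gradient_inner[OF assms])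
  finally show ?thesis by (cases "gradient S w") (simp add: inner_axis)
qed

section \<open>The canonical forms in coordinates\<close>

lemma differential_linear: "linear f \<Longrightarrow> differential f z = f"
  by (simp add: differential_def frechet_derivative_linear)

lemma linear_coords:
  "linear (\<lambda>(a::real^'n, b::real^'n, c::real^'n, d::real^'n). a $ i)"
  "linear (\<lambda>(a::real^'n, b::real^'n, c::real^'n, d::real^'n). b $ i)"
  "linear (\<lambda>(a::real^'n, b::real^'n, c::real^'n, d::real^'n). c $ i)"
  "linear (\<lambda>(a::real^'n, b::real^'n, c::real^'n, d::real^'n). d $ i)"
  by (auto intro!: linearI)

lemma omega_ominus_eq:
  "omega_ominus z (q, p, Q, P) (q', p', Q', P') = p \<bullet> q' - p' \<bullet> q - (P \<bullet> Q' - P' \<bullet> Q)"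
  unfolding omega_ominus_def wedge_def
  by (simp add: differential_linear linear_coords inner_vec_def sum_subtractf)

lemma liouville_form_eq:
  "liouville_form (x, X, y, Y) (x', X', y', Y') = y \<bullet> x' + Y \<bullet> X'"
  unfolding liouville_form_def
  by (simp add: differential_linear linear_coords inner_vec_def sum.distrib)

text \<open>For fixed \<open>c\<close> the function \<open>\<eta> z \<bullet> c\<close> is linear in
  \<open>z\<close>, hence equal to its own derivative. The formula is the coordinate form of
  d(\<eta> d\<pi>) = d\<eta> \<and> d\<pi>.\<close>

lemma ext_derivative_bilinear:
  assumes "linear \<pi>" "linear \<eta>"
  shows "ext_derivative (\<lambda>z v. \<eta> z \<bullet> \<pi> v) z u v = \<eta> u \<bullet> \<pi> v - \<eta> v \<bullet> \<pi> u"
proof -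
  have "linear (\<lambda>z. \<eta> z \<bullet> c)" for c
    using assms(2) by (intro linearI) (simp_all add: linear_add linear_cmul inner_left_distrib)
  then show ?thesis
    by (simp add: ext_derivative_def frechet_derivative_linear)
qed

lemma ext_derivative_liouville_form:
  fixes x X :: "real ^ 'n"
  shows "ext_derivative liouville_form z (x, X, y, Y) (x', X', y', Y') =
    y \<bullet> x' + Y \<bullet> X' - (y' \<bullet> x + Y' \<bullet> X)"
proof -
  define \<pi> \<eta> :: "'n::finite coords \<Rightarrow> _" where
    "\<pi> = (\<lambda>(x, X, y, Y). (x, X))" and "\<eta> = (\<lambda>(x, X, y, Y). (y, Y))"
  have "linear \<pi>" "linear \<eta>" by (auto intro!: linearI simp: \<pi>_def \<eta>_def)
  moreover have eq: "liouville_form = (\<lambda>z v. \<eta> z \<bullet> \<pi> v)"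
    by (auto simp: fun_eq_iff liouville_form_eq \<pi>_def \<eta>_def)
  ultimately show ?thesis
    unfolding eq by (subst ext_derivative_bilinear) (auto simp: \<pi>_def \<eta>_def)
qed

text \<open>A linear map is its own derivative at every point, so compatibility with the two forms
  becomes an algebraic identity. The global linear inverse \<open>g\<close> is smooth, and
  surjectivity makes the image open.\<close>

lemma symplectomorphism_linear:
  assumes "open M" "linear f" "linear g" "\<And>z. g (f z) = z" "\<And>w. f (g w) = w"
    "\<And>z u v. \<omega>' (f z) (f u) (f v) = \<omega> z u v"
  shows "symplectomorphism M \<omega> (f ` M) \<omega>' f"
proof -
  have "surj f"
    using assms(5) by (rule surjI)
  with assms(1,2) have "open (f ` M)"
    by (rule open_surjective_linear_image)
  moreover have "homeomorphism M (f ` M) f g"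
    using assms(2-5)
    by (simp add: homeomorphism_def image_image linear_continuous_on linear_conv_bounded_linear)
  moreover have "pullback2 f \<omega>' z = \<omega> z" for z
    using assms(2,6) by (simp add: pullback2_def fun_eq_iff frechet_derivative_linear)
  ultimately show ?thesis
    using assms(1) smooth_on_linear[OF assms(2)] smooth_on_linear[OF assms(3)]
    unfolding symplectomorphism_def by blast
qed

section \<open>Linear Darboux coordinates\<close>

text \<open>Here \<open>\<pi>\<close> plays the role of position and \<open>\<eta>\<close> of
  conjugate momentum, \<open>\<sigma>\<close> rebuilds a point from both, and \<open>omega\<close>
  states that the symplectic form is canonical in them. Each type of generating function gives one
  instance, with \<open>\<pi>\<close> its variables.\<close>

locale darboux_coords =
  fixes \<pi> \<eta> :: "'n::finite coords \<Rightarrow> (real ^ 'n) \<times> (real ^ 'n)"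
    and \<sigma> :: "((real ^ 'n) \<times> (real ^ 'n)) \<times> ((real ^ 'n) \<times> (real ^ 'n)) \<Rightarrow> 'n coords"
  assumes linear_\<pi>: "linear \<pi>" and linear_\<eta>: "linear \<eta>" and linear_\<sigma>: "linear \<sigma>"
    and \<pi>_\<sigma>: "\<pi> (\<sigma> (w, e)) = w" and \<eta>_\<sigma>: "\<eta> (\<sigma> (w, e)) = e" and \<sigma>_\<pi>_\<eta>: "\<sigma> (\<pi> z, \<eta> z) = z"
    and omega: "omega_ominus z u v = \<eta> u \<bullet> \<pi> v - \<eta> v \<bullet> \<pi> u"
begin

lemma surj_\<pi>: "surj \<pi>"
  using \<pi>_\<sigma> by (rule surjI)

lemma liouvillian_form: "liouvillian_form M (\<lambda>z v. \<eta> z \<bullet> \<pi> v)"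
proof -
  have "linear (\<lambda>v. \<eta> z \<bullet> \<pi> v)" "linear (\<lambda>z. \<eta> z \<bullet> \<pi> v)" for z v
    using linear_\<pi> linear_\<eta>
    by (intro linearI; simp add: linear_add linear_cmul inner_left_distrib inner_right_distrib)+
  then show ?thesis
    using linear_\<pi> linear_\<eta>
    by (auto simp: liouvillian_form_def smooth_one_form_on_def smooth_on_linear fun_eq_iff
        ext_derivative_bilinear omega)
qed

lemma eq_differential_iff:
  assumes "S differentiable (at (\<pi> z))"
  shows "(\<lambda>v. \<eta> z \<bullet> \<pi> v) = differential (S \<circ> \<pi>) z \<longleftrightarrow> \<eta> z = gradient S (\<pi> z)"
proof -
  have "differential (S \<circ> \<pi>) z = (\<lambda>v. gradient S (\<pi> z) \<bullet> \<pi> v)"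
    unfolding differential_def
      frechet_derivative_compose[OF linear_imp_differentiable[OF linear_\<pi>] assms]
    using linear_\<pi> by (simp add: frechet_derivative_linear gradient_inner[OF assms] comp_def)
  then have "(\<lambda>v. \<eta> z \<bullet> \<pi> v) = differential (S \<circ> \<pi>) z \<longleftrightarrow>
      (\<forall>v. \<eta> z \<bullet> \<pi> v = gradient S (\<pi> z) \<bullet> \<pi> v)"
    by (simp add: fun_eq_iff)
  \<comment> \<open>Surjectivity of \<open>\<pi>\<close> makes the test vectors arbitrary; vectors
    with equal inner products against all of them coincide.\<close>
  also have "\<dots> \<longleftrightarrow> (\<forall>w. \<eta> z \<bullet> w = gradient S (\<pi> z) \<bullet> w)"
    by (metis surj_\<pi> surjD)
  also have "\<dots> \<longleftrightarrow> \<eta> z = gradient S (\<pi> z)"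
    by (metis vector_eq_rdot)
  finally show ?thesis .
qed

text \<open>The map \<open>\<phi>\<close> parametrizes the graph of the gradient globally, with
  inverse \<open>\<pi>\<close>, so a single chart with \<open>U = UNIV\<close> serves every point.
  The pulled-back form is the antisymmetric part of the Hessian, up to a factor, and
  vanishes.\<close>

lemma lagrangian_gradient_graph:
  assumes "open M" "smooth_on (\<pi> ` M) S"
  shows "lagrangian_submanifold {z \<in> M. \<eta> z = gradient S (\<pi> z)}" (is "lagrangian_submanifold ?L")
proof -
  have op: "open (\<pi> ` M)"
    using assms(1) linear_\<pi> surj_\<pi> by (rule open_surjective_linear_image)
  define \<phi> where "\<phi> w = \<sigma> (w, gradient S w)" for w
  define V where "V = \<pi> ` M \<inter> \<phi> -` M"
  have smooth_grad: "smooth_on (\<pi> ` M) (gradient S)"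
    using op assms(2) by (rule smooth_on_gradient)
  have smooth_\<phi>: "smooth_on (\<pi> ` M) \<phi>"
    unfolding \<phi>_def[abs_def]
    by (rule smooth_on_linear_compose[OF op linear_\<sigma>
          smooth_on_Pair[OF op smooth_on_linear[OF linear_ident] smooth_grad]])
  have open_V: "open V"
    unfolding V_def
    using smooth_on_imp_continuous_on[OF smooth_\<phi>] op assms(1) by (rule continuous_open_preimage)
  have \<pi>_\<phi>: "\<pi> (\<phi> w) = w" for w by (simp add: \<phi>_def \<pi>_\<sigma>)
  have homeo: "homeomorphism V (?L \<inter> UNIV) \<phi> \<pi>"
  proof (rule homeomorphismI)
    show "continuous_on V \<phi>"
      using smooth_on_imp_continuous_on[OF smooth_\<phi>] by (rule continuous_on_subset) (simp add: V_def)
    show "continuous_on (?L \<inter> UNIV) \<pi>"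
      using linear_\<pi> by (simp add: linear_continuous_on linear_conv_bounded_linear)
    show "\<phi> ` V \<subseteq> ?L \<inter> UNIV"
      by (simp add: image_subset_iff V_def \<phi>_def \<pi>_\<sigma> \<eta>_\<sigma>)
    show *: "\<phi> (\<pi> z) = z" if "z \<in> ?L \<inter> UNIV" for z
      using that \<sigma>_\<pi>_\<eta>[of z] by (simp add: \<phi>_def)
    show "\<pi> ` (?L \<inter> UNIV) \<subseteq> V"
      using * by (auto simp: V_def)
    show "\<pi> (\<phi> w) = w" for w by (rule \<pi>_\<phi>)
  qed
  have "inj (frechet_derivative \<phi> (at w)) \<and> (\<forall>u v. pullback2 \<phi> omega_ominus w u v = 0)"
    if "w \<in> V" for w
  proof -
    have w: "w \<in> \<pi> ` M" using that by (simp add: V_def)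
    define H where "H = frechet_derivative (gradient S) (at w)"
    have H: "(gradient S has_derivative H) (at w)"
      using smooth_on_imp_differentiable[OF smooth_grad w]
      by (simp add: H_def frechet_derivative_works)
    have "(\<phi> has_derivative (\<lambda>u. \<sigma> (u, H u))) (at w)"
      unfolding \<phi>_def[abs_def] using linear_\<sigma>
      by (intro bounded_linear.has_derivative[of \<sigma>] has_derivative_Pair H)
         (auto simp: linear_conv_bounded_linear)
    then have D: "frechet_derivative \<phi> (at w) = (\<lambda>u. \<sigma> (u, H u))"
      by (rule frechet_derivative_at[symmetric])
    have second: "frechet_derivative (\<lambda>x. frechet_derivative S (at x) v) (at w) u = H u \<bullet> v" for u v
    proof -
      have "((\<lambda>x. gradient S x \<bullet> v) has_derivative (\<lambda>u. H u \<bullet> v)) (at w)"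
        using H by (rule has_derivative_inner_left)
      then have "((\<lambda>x. frechet_derivative S (at x) v) has_derivative (\<lambda>u. H u \<bullet> v)) (at w)"
        by (rule has_derivative_transform_within_open[OF _ op w])
           (simp add: gradient_inner smooth_on_imp_differentiable[OF assms(2)])
      then show ?thesis by (metis frechet_derivative_at)
    qed
    have "H u \<bullet> v = H v \<bullet> u" for u v
      using second_derivative_symmetric[OF op assms(2) w, of v u] by (simp add: second)
    \<comment> \<open>By \<open>omega\<close> and \<open>D\<close> the pulled-back form is
      \<open>H u \<bullet> v - H v \<bullet> u\<close>.\<close>
    then have "pullback2 \<phi> omega_ominus w u v = 0" for u v
      by (simp add: pullback2_def D omega \<pi>_\<sigma> \<eta>_\<sigma>)
    moreover have "inj (frechet_derivative \<phi> (at w))"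
      unfolding D by (rule inj_on_inverseI[where g = \<pi>]) (rule \<pi>_\<sigma>)
    ultimately show ?thesis by blast
  qed
  moreover have "smooth_on V \<phi>"
    using smooth_\<phi> by (rule smooth_on_subset) (simp add: V_def)
  ultimately show ?thesis
    unfolding lagrangian_submanifold_def using open_V homeo
    by (intro ballI exI[of _ UNIV] exI[of _ V] exI[of _ \<phi>] exI[of _ \<pi>] conjI) simp_all
qed

text \<open>Both sets in the definition reduce to the same gradient graph: the solution set by the
  third assumption, the coincidence set by \<open>eq_differential_iff\<close>.\<close>

lemma associated_to:
  assumes "open M" "gen_vars t = \<pi>"
    "\<And>S z. S differentiable (at (\<pi> z)) \<Longrightarrow> gen_equations t S z \<longleftrightarrow> \<eta> z = gradient S (\<pi> z)"
  shows "associated_to M (\<lambda>z v. \<eta> z \<bullet> \<pi> v) t"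
  unfolding associated_to_def assms(2)
proof (intro allI impI)
  fix S :: "(real ^ 'n) \<times> (real ^ 'n) \<Rightarrow> real"
  assume S: "smooth_on (\<pi> ` M) S"
  then have "S differentiable (at (\<pi> z))" if "z \<in> M" for z
    using that smooth_on_imp_differentiable by blast
  then have "{z \<in> M. gen_equations t S z} = {z \<in> M. \<eta> z = gradient S (\<pi> z)}"
    "{z \<in> M. (\<lambda>v. \<eta> z \<bullet> \<pi> v) = differential (S \<circ> \<pi>) z} = {z \<in> M. \<eta> z = gradient S (\<pi> z)}"
    by (simp_all add: assms(3) eq_differential_iff cong: conj_cong)
  then show "lagrangian_submanifold {z \<in> M. gen_equations t S z} \<and>
      {z \<in> M. (\<lambda>v. \<eta> z \<bullet> \<pi> v) = differential (S \<circ> \<pi>) z} = {z \<in> M. gen_equations t S z}"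
    using lagrangian_gradient_graph[OF assms(1) S] by simp
qed

text \<open>This reduces each type to identities in coordinates: \<open>symp\<close> and
  \<open>pull\<close> describe \<open>f\<close>, and \<open>gen\<close> matches the equations of the
  type with the gradient equation.\<close>

lemma associated_pullback:
  assumes "open M" "linear f" "linear g" "\<And>z. g (f z) = z" "\<And>w. f (g w) = w"
    and symp: "\<And>z u v. ext_derivative liouville_form (f z) (f u) (f v) = omega_ominus z u v"
    and pull: "\<And>z v. liouville_form (f z) (f v) = \<eta> z \<bullet> \<pi> v"
    and gen: "gen_vars t = \<pi>"
    "\<And>S z. S differentiable (at (\<pi> z)) \<Longrightarrow> gen_equations t S z \<longleftrightarrow> \<eta> z = gradient S (\<pi> z)"
  shows "symplectomorphism M omega_ominus (f ` M) (ext_derivative liouville_form) f \<and> surj f \<and>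
      liouvillian_form M (pullback1 f liouville_form) \<and>
      associated_to M (pullback1 f liouville_form) t"
proof -
  have "pullback1 f liouville_form = (\<lambda>z v. \<eta> z \<bullet> \<pi> v)"
    using assms(2) by (simp add: fun_eq_iff pullback1_def frechet_derivative_linear pull)
  moreover have "surj f" using assms(5) by (rule surjI)
  ultimately show ?thesis
    using symplectomorphism_linear[of M f g "ext_derivative liouville_form" omega_ominus, OF assms(1-6)]
      liouvillian_form associated_to[OF assms(1) gen] by simp
qed

end

section \<open>The four types\<close>

lemma type_I:
  fixes M :: "'n::finite coords set"
  assumes "open M"
  shows "symplectomorphism M omega_ominus (E_1 ` M) (ext_derivative liouville_form) E_1 \<and>
    surj (E_1 :: 'n coords \<Rightarrow> _) \<and> liouvillian_form M (pullback1 E_1 liouville_form) \<and>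
    associated_to M (pullback1 E_1 liouville_form) Type_I"
proof -
  \<comment> \<open>The pulled-back form is p dq - P dQ: the sign in the base coordinate -Q of
    \<open>E_1\<close> moves to the momentum, so the variables are exactly (q, Q).\<close>
  interpret darboux_coords "(\<lambda>(q, p, Q, P). (q, Q)) :: 'n coords \<Rightarrow> _"
    "\<lambda>(q, p, Q, P). (p, - P)" "\<lambda>((q, Q), (p, P)). (q, p, Q, - P)"
    by unfold_locales (auto intro!: linearI simp: omega_ominus_eq)
  show ?thesis
    \<comment> \<open>The equations of the type read P = -b and the gradient equation -P = b; the
      two \<open>add_eq_0\<close> rules bring both to P + b = 0.\<close>
    by (rule associated_pullback[where g = "\<lambda>(x, X, y, Y). (x, y, - X, Y)"])
       (auto intro!: linearI simp: E_1_def assms fun_eq_iff omega_ominus_eq liouville_form_eq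
         ext_derivative_liouville_form partial1_eq_gradient partial2_eq_gradient prod_eq_iff
         vec_eq_iff all_conj_distrib eq_neg_iff_add_eq_0 neg_eq_iff_add_eq_0)
qed

lemma type_II:
  fixes M :: "'n::finite coords set"
  assumes "open M"
  shows "symplectomorphism M omega_ominus (Psi_ii ` M) (ext_derivative liouville_form) Psi_ii \<and>
    surj (Psi_ii :: 'n coords \<Rightarrow> _) \<and> liouvillian_form M (pullback1 Psi_ii liouville_form) \<and>
    associated_to M (pullback1 Psi_ii liouville_form) Type_II"
proof -
  \<comment> \<open>The pulled-back form is p dq + Q dP.\<close>
  interpret darboux_coords "(\<lambda>(q, p, Q, P). (q, P)) :: 'n coords \<Rightarrow> _"
    "\<lambda>(q, p, Q, P). (p, Q)" "\<lambda>((q, P), (p, Q)). (q, p, Q, P)"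
    by unfold_locales (auto intro!: linearI simp: omega_ominus_eq inner_commute)
  show ?thesis
    by (rule associated_pullback[where g = "\<lambda>(x, X, y, Y). (x, y, Y, X)"])
       (auto intro!: linearI simp: Psi_ii_def assms fun_eq_iff omega_ominus_eq liouville_form_eq
         ext_derivative_liouville_form partial1_eq_gradient partial2_eq_gradient prod_eq_iff
         vec_eq_iff inner_commute all_conj_distrib)
qed

lemma type_III:
  fixes M :: "'n::finite coords set"
  assumes "open M"
  shows "symplectomorphism M omega_ominus (Psi_iii ` M) (ext_derivative liouville_form) Psi_iii \<and>
    surj (Psi_iii :: 'n coords \<Rightarrow> _) \<and> liouvillian_form M (pullback1 Psi_iii liouville_form) \<and>
    associated_to M (pullback1 Psi_iii liouville_form) Type_III"
proof -
  \<comment> \<open>The pulled-back form is -P dQ - q dp.\<close>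
  interpret darboux_coords "(\<lambda>(q, p, Q, P). (Q, p)) :: 'n coords \<Rightarrow> _"
    "\<lambda>(q, p, Q, P). (- P, - q)" "\<lambda>((Q, p), (P, q)). (- q, p, Q, - P)"
    by unfold_locales (auto intro!: linearI simp: omega_ominus_eq inner_commute)
  show ?thesis
    by (rule associated_pullback[where g = "\<lambda>(x, X, y, Y). (- Y, X, x, - y)"])
       (auto intro!: linearI simp: Psi_iii_def assms fun_eq_iff omega_ominus_eq liouville_form_eq
         ext_derivative_liouville_form partial1_eq_gradient partial2_eq_gradient prod_eq_iff
         vec_eq_iff inner_commute all_conj_distrib eq_neg_iff_add_eq_0 neg_eq_iff_add_eq_0)
qed

lemma type_IV:
  fixes M :: "'n::finite coords set"
  assumes "open M"
  shows "symplectomorphism M omega_ominus (Psi_iv ` M) (ext_derivative liouville_form) Psi_iv \<and>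
    surj (Psi_iv :: 'n coords \<Rightarrow> _) \<and> liouvillian_form M (pullback1 Psi_iv liouville_form) \<and>
    associated_to M (pullback1 Psi_iv liouville_form) Type_IV"
proof -
  \<comment> \<open>The pulled-back form is -q dp + Q dP; here too the sign of the base coordinate
    -p moves to its conjugate q.\<close>
  interpret darboux_coords "(\<lambda>(q, p, Q, P). (p, P)) :: 'n coords \<Rightarrow> _"
    "\<lambda>(q, p, Q, P). (- q, Q)" "\<lambda>((p, P), (q, Q)). (- q, p, Q, P)"
    by unfold_locales (auto intro!: linearI simp: omega_ominus_eq inner_commute)
  show ?thesis
    by (rule associated_pullback[where g = "\<lambda>(x, X, y, Y). (y, - x, Y, X)"])
       (auto intro!: linearI simp: Psi_iv_def assms fun_eq_iff omega_ominus_eq liouville_form_eq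
         ext_derivative_liouville_form partial1_eq_gradient partial2_eq_gradient prod_eq_iff
         vec_eq_iff inner_commute all_conj_distrib eq_neg_iff_add_eq_0 neg_eq_iff_add_eq_0)
qed

section \<open>Openness of the product domain and the four types together\<close>

lemma open_product_domain:
  assumes "open M1" "open M2"
  shows "open (product_domain M1 M2)"
proof -
  have "product_domain M1 M2 =
      (\<lambda>z. ((fst z, fst (snd z)), snd (snd z))) -` (M1 \<times> M2)"
    by (auto simp: product_domain_def)
  also have "open \<dots>"
    using assms by (intro open_vimage open_Times continuous_intros)
  finally show ?thesis .
qed

theorem lemma4p2:
  fixes M1 M2 :: "((real ^ 'n::finite) \<times> (real ^ 'n)) set"
    and M :: "'n coords set"
  assumes "open M1" and "open M2" and "M = product_domain M1 M2"
  shows "(\<forall>f \<in> {E_1, Psi_ii, Psi_iii, Psi_iv}.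
            symplectomorphism M omega_ominus (f ` M) (ext_derivative liouville_form) f \<and> surj f \<and>
            liouvillian_form M (pullback1 f liouville_form)) \<and>
         associated_to M (pullback1 E_1 liouville_form) Type_I \<and>
         associated_to M (pullback1 Psi_ii liouville_form) Type_II \<and>
         associated_to M (pullback1 Psi_iii liouville_form) Type_III \<and>
         associated_to M (pullback1 Psi_iv liouville_form) Type_IV"
proof -
  have "open M"
    using assms open_product_domain by blast
  from type_I[OF this] type_II[OF this] type_III[OF this] type_IV[OF this]
  show ?thesis by blast
qed

end
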